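(* Let $f\colon [0,\infty)\to (0,\infty)$ be a non-decreasing function such that $\sum_{n=1}^{\infty} \frac{1}{f(2^n)}=\infty$. Let $0<r<2$ and let $p\geq r$. Then there exists a sequence of independent, centered random variables $\{X_n\}_{n\geq 1}$ such that $\sup_{n\geq 1} \mathbb{E}(|X_n|^p f(|X_n|))<\infty$ and $$\sum_{n=1}^{\infty} n^{p/r-2}\, \mathbb{P}(|S_n|> n^{1/r})=\infty.$$ Moreover, if $r=p$ then (this sequence also satisfies) $\limsup_{n\to \infty} n^{-1/p}S_n\geq 1$ almost surely.
   Context: All random variables are real-valued and those in a sequence $\{X_n\}_{n\geq 1}$ are defined on the same probability space. For $n\geq 1$ let $S_n=\sum_{i=1}^n X_i$. A random variable $X$ is centered if $\mathbb{E}(X)=0$. *)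

theory Defs
  imports "HOL-Probability.Probability"
begin

(* Integrability is part of the notion: the Bochner integral of a non-integrable
   function is 0 by convention. *)
definition centered :: "'a measure \<Rightarrow> ('a \<Rightarrow> real) \<Rightarrow> bool" where
  "centered M Y \<longleftrightarrow> integrable M Y \<and> integral\<^sup>L M Y = 0"

(* Sequences are indexed from 1; the value of X at index 0 plays no role. *)
definition partial_sum :: "(nat \<Rightarrow> 'a \<Rightarrow> real) \<Rightarrow> nat \<Rightarrow> 'a \<Rightarrow> real" where
  "partial_sum X n \<omega> = (\<Sum>i=1..n. X i \<omega>)"

end

theory Submission
  imports Defs
begin

text \<open>
  Put \<open>a = 1 / r\<close> and let \<open>X n\<close> jump up to \<open>K * n powr a\<close>, with \<open>K = 3 * 2 powr a\<close>, with probability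
  \<open>q n = c / (n powr (p * a) * f (K * n powr a))\<close>; this makes the moment contributed by the jump
  constant. The mean is compensated at negative values that never matter. If \<open>p \<ge> 1\<close>, a small
  deterministic drift does it, and the drifts add up to at most \<open>n powr a\<close>. If \<open>p < 1\<close>, that drift
  would have unbounded moments; instead there is a huge negative value \<open>- y\<close> of summably small
  probability, whose moment is harmless because \<open>y powr (p - 1) * f y\<close> becomes arbitrarily small.
  Hence a single upward jump at a time in \<open>{n div 2<..n}\<close> forces \<open>S n > n powr a\<close>, which has
  probability at least of order \<open>n * q n\<close>, and the series dominates a multiple of
  \<open>\<Sum>n. 1 / (n * f (K * n powr a))\<close>, divergent by condensation. For \<open>p = r\<close> this series is the sum
  of the \<open>q n\<close>, so both Borel--Cantelli lemmas give the statement on the limes superior.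
\<close>

section \<open>Independent events: second Borel-Cantelli lemma and a lower bound for unions\<close>

text \<open>By independence the chance that none of the events with index in
  \<open>{m..<m + n}\<close> occurs is the product of the \<open>1 - q i\<close>, which is at most
  \<open>exp\<close> of minus the sum of the \<open>q i\<close>. Divergence makes that sum
  arbitrarily large, so for each of the countably many \<open>m\<close> the bad event
  \<open>C\<close> is null.\<close>

lemma (in prob_space) borel_cantelli_2:
  assumes indep: "indep_vars N X (UNIV :: nat set)"
    and B: "\<And>i. B i \<in> sets (N i)"
    and div: "\<not> summable (\<lambda>i. prob (X i -` B i \<inter> space M))"
  shows "AE \<omega> in M. \<exists>\<^sub>\<infinity>i. X i \<omega> \<in> B i"
proof -
  define q where "q i = prob (X i -` B i \<inter> space M)" for i
  have rv [measurable]: "X i \<in> measurable M (N i)" for i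
    using indep by (auto simp: indep_vars_def2)
  note B [measurable]
  have q: "0 \<le> q i" "q i \<le> 1" for i
    by (auto simp: q_def)
  have "AE \<omega> in M. \<exists>i\<ge>m. X i \<omega> \<in> B i" for m
  proof -
    define C where "C = {\<omega> \<in> space M. \<forall>i\<ge>m. X i \<omega> \<notin> B i}"
    have C [measurable]: "C \<in> events"
      unfolding C_def by measurable
    have "prob C \<le> exp (- (\<Sum>i\<in>{m..<m + n}. q i))" if "n > 0" for n
    proof -
      have "prob C \<le> prob (\<Inter>i\<in>{m..<m + n}. X i -` (space (N i) - B i) \<inter> space M)"
        by (rule finite_measure_mono) (use that in \<open>auto simp: C_def dest: measurable_space[OF rv]\<close>)
      also have "\<dots> = (\<Prod>i\<in>{m..<m + n}. prob (X i -` (space (N i) - B i) \<inter> space M))"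
        by (rule indep_varsD[OF indep]) (use that in auto)
      also have "\<dots> = (\<Prod>i\<in>{m..<m + n}. 1 - q i)"
      proof (rule prod.cong)
        fix i
        have "X i -` (space (N i) - B i) \<inter> space M = space M - X i -` B i \<inter> space M"
          by (auto dest: measurable_space[OF rv])
        then show "prob (X i -` (space (N i) - B i) \<inter> space M) = 1 - q i"
          by (simp add: q_def prob_compl)
      qed simp
      also have "\<dots> \<le> (\<Prod>i\<in>{m..<m + n}. exp (- q i))"
        by (intro prod_mono) (use q exp_ge_add_one_self[of "- q _"] in auto)
      also have "\<dots> = exp (- (\<Sum>i\<in>{m..<m + n}. q i))"
        by (simp add: exp_sum flip: sum_negf)
      finally show ?thesis .
    qed
    moreover have "\<exists>n>0. (\<Sum>i\<in>{m..<m + n}. q i) \<ge> x" for x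
    proof (rule ccontr)
      assume H: "\<not> ?thesis"
      have "summable (\<lambda>i. q (i + m))"
      proof (rule summableI_nonneg_bounded[where x = "max x 0"])
        show "(\<Sum>i<n. q (i + m)) \<le> max x 0" for n
        proof (cases "n > 0")
          case True
          have "(\<Sum>i<n. q (i + m)) = (\<Sum>i\<in>{m..<m + n}. q i)"
            by (rule sum.reindex_bij_witness[where i = "\<lambda>i. i - m" and j = "\<lambda>i. i + m"]) auto
          moreover have "\<dots> < x" using H True by (meson not_le)
          ultimately show ?thesis by simp
        qed auto
      qed (use q in auto)
      then have "summable q" by (simp add: summable_iff_shift)
      with div show False by (simp add: q_def[abs_def])
    qed
    ultimately have le: "prob C \<le> exp (- x)" for x
      by (metis exp_le_cancel_iff neg_le_iff_le order_trans)
    have "prob C = 0"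
    proof (rule ccontr)
      assume "prob C \<noteq> 0"
      then have "prob C > 0" by (simp add: zero_less_measure_iff)
      with le[of "- ln (prob C / 2)"] show False by simp
    qed
    then have "AE \<omega> in M. \<omega> \<notin> C"
      using C by (simp add: prob_eq_0)
    then show ?thesis
      by (rule AE_mp) (auto simp: C_def)
  qed
  then show ?thesis
    by (simp add: INFM_nat_le AE_all_countable)
qed

lemma (in prob_space) indep_vars_prob_Int:
  assumes indep: "indep_vars N X I" and "i \<in> I" "j \<in> I" "i \<noteq> j"
    and "A \<in> sets (N i)" "B \<in> sets (N j)"
  shows "prob ((X i -` A \<inter> space M) \<inter> (X j -` B \<inter> space M)) =
    prob (X i -` A \<inter> space M) * prob (X j -` B \<inter> space M)"
proof -
  have "\<And>k. k \<in> {i, j} \<Longrightarrow> (if k = i then A else B) \<in> sets (N k)"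
    using assms by auto
  from indep_varsD[OF indep, of "{i, j}", OF _ _ _ this] assms show ?thesis by auto
qed

text \<open>Removing from \<open>A i\<close> the forbidden events (\<open>U i\<close>) and all
  \<open>A j\<close> of smaller index (\<open>V i\<close>) leaves disjoint events
  \<open>E i\<close>, whose probabilities add up. By pairwise independence the two removals cost at
  most the fractions \<open>b\<close> and \<open>a\<close> of \<open>prob (A i)\<close>.\<close>

lemma (in prob_space) prob_UN_pairwise_indep_ge:
  fixes A N :: "nat \<Rightarrow> 'a set"
  assumes fin: "finite I" "finite J"
    and ev: "\<And>i. i \<in> I \<Longrightarrow> A i \<in> events" "\<And>j. j \<in> J \<Longrightarrow> N j \<in> events"
    and AA: "\<And>i j. i \<in> I \<Longrightarrow> j \<in> I \<Longrightarrow> i \<noteq> j \<Longrightarrow> prob (A i \<inter> A j) = prob (A i) * prob (A j)"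
    and AN: "\<And>i j. i \<in> I \<Longrightarrow> j \<in> J \<Longrightarrow> i \<noteq> j \<Longrightarrow> prob (A i \<inter> N j) = prob (A i) * prob (N j)"
  shows "(1 - (\<Sum>i\<in>I. prob (A i)) - (\<Sum>j\<in>J. prob (N j))) * (\<Sum>i\<in>I. prob (A i))
    \<le> prob (\<Union>i\<in>I. A i - (\<Union>j\<in>J - {i}. N j))"
proof -
  define a b where "a = (\<Sum>i\<in>I. prob (A i))" and "b = (\<Sum>j\<in>J. prob (N j))"
  define U V where "U i = (\<Union>j\<in>J - {i}. A i \<inter> N j)" and "V i = (\<Union>j\<in>{j \<in> I. j < i}. A i \<inter> A j)" for i
  define E where "E i = A i - (U i \<union> V i)" for i
  have UV: "U i \<in> events" "V i \<in> events" if "i \<in> I" for i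
    unfolding U_def V_def using fin ev that by (auto intro!: sets.finite_UN)
  then have E: "E i \<in> events" if "i \<in> I" for i
    unfolding E_def using ev that by auto
  have lower: "(1 - a - b) * prob (A i) \<le> prob (E i)" if i: "i \<in> I" for i
  proof -
    have "prob (U i) \<le> (\<Sum>j\<in>J - {i}. prob (A i \<inter> N j))"
      unfolding U_def by (rule finite_measure_subadditive_finite) (use fin ev i in auto)
    also have "\<dots> = prob (A i) * (\<Sum>j\<in>J - {i}. prob (N j))"
      unfolding sum_distrib_left by (rule sum.cong) (use AN i in auto)
    also have "\<dots> \<le> prob (A i) * b"
      unfolding b_def by (intro mult_left_mono sum_mono2) (use fin in auto)
    finally have 1: "prob (U i) \<le> prob (A i) * b" .
    have "prob (V i) \<le> (\<Sum>j\<in>{j \<in> I. j < i}. prob (A i \<inter> A j))"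
      unfolding V_def by (rule finite_measure_subadditive_finite) (use fin ev i in auto)
    also have "\<dots> = prob (A i) * (\<Sum>j\<in>{j \<in> I. j < i}. prob (A j))"
      unfolding sum_distrib_left by (rule sum.cong) (use AA i in auto)
    also have "\<dots> \<le> prob (A i) * a"
      unfolding a_def by (intro mult_left_mono sum_mono2) (use fin in auto)
    finally have 2: "prob (V i) \<le> prob (A i) * a" .
    have "U i \<union> V i \<subseteq> A i" by (auto simp: U_def V_def)
    then have "prob (E i) = prob (A i) - prob (U i \<union> V i)"
      unfolding E_def using ev(1)[OF i] UV[OF i] by (intro finite_measure_Diff) auto
    moreover have "prob (U i \<union> V i) \<le> prob (U i) + prob (V i)"
      using UV[OF i] by (rule measure_Un_le)
    ultimately show ?thesis using 1 2 by (simp add: algebra_simps)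
  qed
  have "(1 - a - b) * a \<le> (\<Sum>i\<in>I. prob (E i))"
    by (subst (2) a_def) (auto simp: sum_distrib_left intro!: sum_mono lower)
  also have "\<dots> = prob (\<Union>i\<in>I. E i)"
  proof (rule finite_measure_finite_Union[symmetric])
    show "disjoint_family_on E I"
      unfolding disjoint_family_on_def
    proof (intro ballI impI)
      fix m n assume "m \<in> I" "n \<in> I" "m \<noteq> n"
      then show "E m \<inter> E n = {}"
        by (cases m n rule: linorder_cases) (auto simp: E_def V_def)
    qed
  qed (use fin E in auto)
  also have "\<dots> \<le> prob (\<Union>i\<in>I. A i - (\<Union>j\<in>J - {i}. N j))"
    by (rule finite_measure_mono)
      (use fin ev in \<open>auto simp: E_def U_def intro!: sets.finite_UN sets.Diff\<close>)
  finally show ?thesis by (simp add: a_def b_def)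
qed

section \<open>Partial sums driven by one large jump\<close>

text \<open>A jump above \<open>2 * t\<close> at \<open>i\<close>, with every other
  \<open>X j\<close> at least \<open>- h j\<close>, leaves a sum above \<open>2 * t - t\<close>. The
  event \<open>N i\<close> of the jump index is not excluded, as it concerns the same variable as
  \<open>A i\<close>. The two bounds 1/4 leave the factor 1/2.\<close>

lemma (in prob_space) prob_partial_sum_gt:
  assumes indep: "indep_vars (\<lambda>_. borel) X UNIV"
    and h: "\<And>j. 0 \<le> h j" "(\<Sum>j=1..n. h j) \<le> t"
    and I: "I \<subseteq> {1..n}" "\<And>i. i \<in> I \<Longrightarrow> 2 * t < x i"
    and up: "(\<Sum>i\<in>I. prob {\<omega> \<in> space M. x i \<le> X i \<omega>}) \<le> 1 / 4"
    and low: "(\<Sum>j=1..n. prob {\<omega> \<in> space M. X j \<omega> < - h j}) \<le> 1 / 4"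
  shows "(\<Sum>i\<in>I. prob {\<omega> \<in> space M. x i \<le> X i \<omega>}) / 2
    \<le> prob {\<omega> \<in> space M. t < \<bar>partial_sum X n \<omega>\<bar>}"
proof -
  have rv [measurable]: "X i \<in> borel_measurable M" for i
    using indep by (auto simp: indep_vars_def2)
  define A N where "A i = X i -` {x i..} \<inter> space M" and "N j = X j -` {..<- h j} \<inter> space M" for i j
  have ev: "A i \<in> events" "N i \<in> events" for i
    unfolding A_def N_def by measurable
  have A: "{\<omega> \<in> space M. x i \<le> X i \<omega>} = A i" and N: "{\<omega> \<in> space M. X i \<omega> < - h i} = N i" for i
    by (auto simp: A_def N_def)
  have fin: "finite I" using I finite_subset by blast
  define s where "s = (\<Sum>i\<in>I. prob (A i))"
  have "0 \<le> s" unfolding s_def by (intro sum_nonneg) auto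
  have "s \<le> 1 / 4" "(\<Sum>j=1..n. prob (N j)) \<le> 1 / 4"
    using up low unfolding A N s_def .
  then have "1 / 2 \<le> 1 - s - (\<Sum>j=1..n. prob (N j))" by linarith
  from mult_right_mono[OF this \<open>0 \<le> s\<close>]
  have "s / 2 \<le> (1 - s - (\<Sum>j=1..n. prob (N j))) * s" by simp
  also have "\<dots> \<le> prob (\<Union>i\<in>I. A i - (\<Union>j\<in>{1..n} - {i}. N j))"
    unfolding s_def
  proof (rule prob_UN_pairwise_indep_ge)
    show "prob (A i \<inter> A j) = prob (A i) * prob (A j)" if "i \<noteq> j" for i j
      unfolding A_def by (rule indep_vars_prob_Int[OF indep]) (use that in auto)
    show "prob (A i \<inter> N j) = prob (A i) * prob (N j)" if "i \<noteq> j" for i j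
      unfolding A_def N_def by (rule indep_vars_prob_Int[OF indep]) (use that in auto)
  qed (use fin ev in auto)
  also have "\<dots> \<le> prob {\<omega> \<in> space M. t < \<bar>partial_sum X n \<omega>\<bar>}"
  proof (rule finite_measure_mono)
    show "{\<omega> \<in> space M. t < \<bar>partial_sum X n \<omega>\<bar>} \<in> events"
      unfolding partial_sum_def by measurable
    show "(\<Union>i\<in>I. A i - (\<Union>j\<in>{1..n} - {i}. N j)) \<subseteq> {\<omega> \<in> space M. t < \<bar>partial_sum X n \<omega>\<bar>}"
    proof
      fix \<omega> assume "\<omega> \<in> (\<Union>i\<in>I. A i - (\<Union>j\<in>{1..n} - {i}. N j))"
      then obtain i where i: "i \<in> I" "\<omega> \<in> A i" "\<And>j. j \<in> {1..n} - {i} \<Longrightarrow> \<omega> \<notin> N j" by blast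
      have \<omega>: "\<omega> \<in> space M" and "x i \<le> X i \<omega>" using i(2) by (auto simp: A_def)
      then have "2 * t < X i \<omega>" using I(2)[OF i(1)] by linarith
      moreover have "- t \<le> (\<Sum>j\<in>{1..n} - {i}. X j \<omega>)"
      proof -
        have "(\<Sum>j\<in>{1..n} - {i}. h j) \<le> (\<Sum>j=1..n. h j)"
          by (rule sum_mono2) (use h in auto)
        with h(2) have "- t \<le> (\<Sum>j\<in>{1..n} - {i}. - h j)"
          by (simp add: sum_negf)
        also have "\<dots> \<le> (\<Sum>j\<in>{1..n} - {i}. X j \<omega>)"
          by (rule sum_mono) (use i(3) \<omega> in \<open>auto simp: N_def not_less\<close>)
        finally show ?thesis .
      qed
      moreover have "partial_sum X n \<omega> = X i \<omega> + (\<Sum>j\<in>{1..n} - {i}. X j \<omega>)"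
        unfolding partial_sum_def by (rule sum.remove) (use i(1) I(1) in auto)
      ultimately show "\<omega> \<in> {\<omega> \<in> space M. t < \<bar>partial_sum X n \<omega>\<bar>}" using \<omega> by auto
    qed
  qed
  finally show ?thesis by (simp add: A s_def)
qed

text \<open>Almost surely the jumps recur, while \<open>X i\<close> falls below \<open>- h i\<close>
  only finitely often. At a late jump the \<open>3 * n powr a\<close> is spent in three parts: one
  absorbs the early terms, one the total drift, and one remains as the lower bound for the partial
  sum.\<close>

lemma (in prob_space) limsup_partial_sum_ge:
  assumes indep: "indep_vars (\<lambda>_. borel) X UNIV" and "0 < a"
    and h: "\<And>n. (\<Sum>j=1..n. h j) \<le> real n powr a"
    and x: "\<And>i. 3 * real i powr a \<le> x i + h i"
    and up: "\<not> summable (\<lambda>i. prob {\<omega> \<in> space M. x i \<le> X i \<omega>})"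
    and low: "summable (\<lambda>i. prob {\<omega> \<in> space M. X i \<omega> < - h i})"
  shows "AE \<omega> in M. 1 \<le> limsup (\<lambda>n. ereal (real n powr (- a) * partial_sum X n \<omega>))"
proof -
  have rv [measurable]: "X i \<in> borel_measurable M" for i
    using indep by (auto simp: indep_vars_def2)
  have "AE \<omega> in M. \<exists>\<^sub>\<infinity>i. X i \<omega> \<in> {x i..}"
  proof (rule borel_cantelli_2[OF indep])
    have "X i -` {x i..} \<inter> space M = {\<omega> \<in> space M. x i \<le> X i \<omega>}" for i by auto
    with up show "\<not> summable (\<lambda>i. prob (X i -` {x i..} \<inter> space M))" by simp
  qed simp
  moreover have "AE \<omega> in M. eventually (\<lambda>i. \<omega> \<in> space M - {\<omega> \<in> space M. X i \<omega> < - h i}) sequentially"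
    by (rule borel_cantelli_AE1[OF _ _ low]) (auto simp: emeasure_eq_measure)
  ultimately show ?thesis
  proof eventually_elim
    fix \<omega>
    assume inf: "\<exists>\<^sub>\<infinity>i. X i \<omega> \<in> {x i..}"
      and ev: "eventually (\<lambda>i. \<omega> \<in> space M - {\<omega> \<in> space M. X i \<omega> < - h i}) sequentially"
    \<comment> \<open>The shift by \<open>h\<close> makes all terms from a random index
      \<open>N\<close> on nonnegative, so the single term \<open>Y n\<close> bounds their sum from
      below; \<open>D\<close> controls the finitely many earlier ones.\<close>
    define Y where "Y i = X i \<omega> + h i" for i
    from ev obtain N where N: "\<And>i. i \<ge> N \<Longrightarrow> 0 \<le> Y i"
      by (force simp: eventually_sequentially Y_def)
    define D where "D = (\<Sum>i=1..N. \<bar>Y i\<bar>)"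
    have "filterlim (\<lambda>n. real n powr a) at_top sequentially"
      by (rule filterlim_compose[OF real_powr_at_top[OF \<open>0 < a\<close>] filterlim_real_sequentially])
    then have "eventually (\<lambda>n. D \<le> real n powr a) sequentially"
      by (simp add: filterlim_at_top)
    then have "eventually (\<lambda>n. N < n \<and> D \<le> real n powr a) sequentially"
      using eventually_gt_at_top[of N] by eventually_elim simp
    then have "\<exists>\<^sub>\<infinity>n. X n \<omega> \<in> {x n..} \<and> N < n \<and> D \<le> real n powr a"
      using inf unfolding cofinite_eq_sequentially
      by (rule_tac frequently_rev_mp[rotated]) (auto elim: eventually_mono)
    then have "\<exists>\<^sub>\<infinity>n. 1 \<le> ereal (real n powr (- a) * partial_sum X n \<omega>)"
    proof (rule INFM_mono)
      fix n assume n: "X n \<omega> \<in> {x n..} \<and> N < n \<and> D \<le> real n powr a"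
      have "{1..n} = {1..N} \<union> {N<..n}" using n by auto
      then have "(\<Sum>i=1..n. Y i) = (\<Sum>i=1..N. Y i) + (\<Sum>i\<in>{N<..n}. Y i)"
        by (simp only:) (rule sum.union_disjoint, auto)
      moreover have "Y n \<le> (\<Sum>i\<in>{N<..n}. Y i)"
        by (rule member_le_sum) (use n N in auto)
      moreover have "- (\<Sum>i=1..N. Y i) \<le> D"
        unfolding D_def sum_negf[symmetric] by (rule sum_mono) auto
      moreover have "(\<Sum>i=1..n. Y i) = partial_sum X n \<omega> + (\<Sum>i=1..n. h i)"
        by (simp add: Y_def partial_sum_def sum.distrib)
      moreover have "x n + h n \<le> Y n" using n by (simp add: Y_def)
      ultimately have "real n powr a \<le> partial_sum X n \<omega>"
        using h[of n] x[of n] n by linarith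
      then have "real n powr (- a) * real n powr a \<le> real n powr (- a) * partial_sum X n \<omega>"
        by (rule mult_left_mono) simp
      then show "1 \<le> ereal (real n powr (- a) * partial_sum X n \<omega>)"
        using n by (simp flip: powr_add)
    qed
    then show "1 \<le> limsup (\<lambda>n. ereal (real n powr (- a) * partial_sum X n \<omega>))"
      \<comment> \<open>A limes superior below 1 would keep the terms below 1 from some index
        on.\<close>
      unfolding cofinite_eq_sequentially frequently_def not_le
      by (rule contrapos_np) (rule Limsup_lessD, simp only: not_le)
  qed
qed

section \<open>Three-point laws and the product space\<close>

text \<open>The atom at 0 may have mass 0: the drift case below takes \<open>v = 1 - u\<close>. The
  law is centered exactly when \<open>x * u = y * v\<close>.\<close>

definition three_point :: "real \<Rightarrow> real \<Rightarrow> real \<Rightarrow> real \<Rightarrow> real pmf" where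
  "three_point x u y v = pmf_of_list [(x, u), (- y, v), (0, 1 - u - v)]"

context
  fixes x u y v :: real
  assumes xy: "0 < x" "0 < y" and uv: "0 \<le> u" "0 \<le> v" "u + v \<le> 1"
begin

lemma three_point_wf: "pmf_of_list_wf [(x, u), (- y, v), (0, 1 - u - v)]"
  using uv by (auto intro!: pmf_of_list_wfI)

lemma measure_three_point:
  "measure (three_point x u y v) A =
    u * indicator A x + v * indicator A (- y) + (1 - u - v) * indicator A 0"
  unfolding three_point_def by (subst measure_pmf_of_list[OF three_point_wf]) (auto simp: indicator_def)

lemma set_three_point: "set_pmf (three_point x u y v) \<subseteq> {x, - y, 0}"
  unfolding three_point_def using set_pmf_of_list[OF three_point_wf] by simp

lemma integral_three_point:
  "(LINT z|three_point x u y v. z) = x * u - y * v"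
proof -
  have "(LINT z|three_point x u y v. z) = (\<Sum>z\<in>{x, - y, 0}. z * pmf (three_point x u y v) z)"
    by (rule integral_measure_pmf_real) (use set_three_point in auto)
  then show ?thesis
    using xy by (simp add: measure_three_point pmf.rep_eq)
qed

lemma nn_integral_three_point:
  assumes "g 0 = 0"
  shows "(\<integral>\<^sup>+z. g z \<partial>three_point x u y v) = g x * u + g (- y) * v"
proof -
  have "(\<integral>\<^sup>+z. g z \<partial>three_point x u y v) = (\<Sum>z\<in>{x, - y, 0}. g z * pmf (three_point x u y v) z)"
    by (rule nn_integral_measure_pmf_support) (use set_three_point in auto)
  then show ?thesis
    using xy assms by (simp add: measure_three_point pmf.rep_eq)
qed

lemma integrable_three_point: "integrable (three_point x u y v) (\<lambda>z. z :: real)"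
  by (rule integrable_measure_pmf_finite) (rule finite_subset[OF set_three_point], simp)

end

text \<open>On the infinite product the joint law of the coordinates is the product measure itself,
  which characterizes their independence.\<close>

lemma prob_space_coordinates:
  fixes \<mu> :: "nat \<Rightarrow> real pmf"
  obtains M :: "(nat \<Rightarrow> real) measure" where "prob_space M"
    "prob_space.indep_vars M (\<lambda>_. borel) (\<lambda>i \<omega>. \<omega> i) UNIV"
    "\<And>i. distr M borel (\<lambda>\<omega>. \<omega> i) = distr (\<mu> i) borel (\<lambda>x. x)"
proof -
  \<comment> \<open>A \<open>pmf\<close> carries the discrete sigma-algebra; the push-forward along
    the identity moves it to the Borel sets.\<close>
  define D where "D i = distr (\<mu> i) borel (\<lambda>x. x :: real)" for i
  define M where "M = PiM UNIV D"
  have D: "prob_space (D i)" for i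
    unfolding D_def by (rule measure_pmf.prob_space_distr) simp
  have sD [measurable_cong]: "sets (D i) = sets borel" for i by (simp add: D_def)
  interpret prob_space M
    unfolding M_def using D by (rule prob_space_PiM)
  have rv [measurable]: "(\<lambda>\<omega>. \<omega> i) \<in> borel_measurable M" for i
    unfolding M_def by measurable
  have dist: "distr M borel (\<lambda>\<omega>. \<omega> i) = D i" for i
  proof -
    have "distr M borel (\<lambda>\<omega>. \<omega> i) = distr M (D i) (\<lambda>\<omega>. \<omega> i)"
      by (rule distr_cong) (auto simp: sD)
    then show ?thesis
      unfolding M_def using distr_PiM_component[of UNIV D i] D by simp
  qed
  have "sets M = sets (PiM UNIV (\<lambda>_. borel))"
    unfolding M_def by (rule sets_PiM_cong) (auto simp: sD)
  then have "distr M (PiM UNIV (\<lambda>_. borel)) (\<lambda>\<omega>. \<lambda>i\<in>UNIV. \<omega> i) = M"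
    by (simp add: restrict_def distr_id2)
  also have "\<dots> = PiM UNIV (\<lambda>i. distr M borel (\<lambda>\<omega>. \<omega> i))"
    unfolding dist by (simp add: M_def)
  finally have "indep_vars (\<lambda>_. borel) (\<lambda>i \<omega>. \<omega> i) UNIV"
    by (subst indep_vars_iff_distr_eq_PiM) auto
  then show ?thesis
    using that[of M] prob_space_axioms dist by (simp add: D_def)
qed

section \<open>Divergent series: condensation and the growth of \<open>f\<close>\<close>

text \<open>The range is cut into blocks of length \<open>m\<close>; as \<open>u\<close> decreases,
  a block sums to at most \<open>m\<close> times its first term.\<close>

lemma summable_of_summable_multiples:
  fixes u :: "nat \<Rightarrow> real"
  assumes "decseq u" and nonneg: "\<And>n. 0 \<le> u n" and "m > 0"
    and sm: "summable (\<lambda>k. u (k * m))"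
  shows "summable u"
proof (rule summableI_nonneg_bounded[OF nonneg])
  fix n
  have "(\<Sum>i<n. u i) \<le> (\<Sum>i<n * m. u i)"
    by (rule sum_mono2) (use nonneg \<open>m > 0\<close> in \<open>auto intro: less_le_trans\<close>)
  also have "\<dots> = (\<Sum>k<n. sum u {k * m..<k * m + m})"
    by (rule sum.nat_group[symmetric])
  also have "\<dots> \<le> (\<Sum>k<n. real m * u (k * m))"
  proof (rule sum_mono)
    fix k
    have "sum u {k * m..<k * m + m} \<le> of_nat (card {k * m..<k * m + m}) * u (k * m)"
      by (rule sum_bounded_above) (use \<open>decseq u\<close> in \<open>auto dest: decseqD\<close>)
    then show "sum u {k * m..<k * m + m} \<le> real m * u (k * m)" by simp
  qed
  also have "\<dots> = real m * (\<Sum>k<n. u (k * m))" by (simp add: sum_distrib_left)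
  also have "\<dots> \<le> real m * (\<Sum>k. u (k * m))"
    by (intro mult_left_mono sum_le_suminf sm) (use nonneg in auto)
  finally show "(\<Sum>i<n. u i) \<le> real m * (\<Sum>k. u (k * m))" .
qed

context
  fixes f :: "real \<Rightarrow> real"
  assumes f_pos: "\<And>x. 0 \<le> x \<Longrightarrow> 0 < f x"
    and f_mono: "mono_on {0..} f"
    and f_div: "\<not> summable (\<lambda>n. 1 / f (2 ^ Suc n))"
begin

lemma recip_antimono: "0 \<le> x \<Longrightarrow> x \<le> y \<Longrightarrow> 1 / f y \<le> 1 / f x"
  using f_pos mono_onD[OF f_mono, of x y] by (auto intro!: divide_left_mono mult_pos_pos)

text \<open>Cauchy condensation turns convergence into that of the sum of
  \<open>1 / f (K * (2 ^ k) powr a)\<close>. These arguments lie below the powers of 2 with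
  exponents \<open>Suc k * m\<close>, so \<open>1 / f (2 ^ n)\<close> is summable along multiples of
  \<open>m\<close>, hence summable, against \<open>f_div\<close>.\<close>

lemma not_summable_powr_dilation:
  fixes K a :: real
  assumes "0 < K" "0 < a"
  shows "\<not> summable (\<lambda>n. 1 / (real n * f (K * real n powr a)))"
proof
  define g where "g n = 1 / (real n * f (K * real n powr a))" for n
  define u where "u n = 1 / f (2 ^ n)" for n :: nat
  assume "summable (\<lambda>n. 1 / (real n * f (K * real n powr a)))"
  then have "summable g" by (simp add: g_def[abs_def])
  \<comment> \<open>Monotonicity starts at 1 because \<open>g 0 = 1 / 0 = 0\<close>.\<close>
  moreover have "g (Suc m) \<le> g m" if "0 < m" for m
  proof -
    have "K * real m powr a \<le> K * real (Suc m) powr a"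
      using assms by (intro mult_left_mono powr_mono2) auto
    then have "f (K * real m powr a) \<le> f (K * real (Suc m) powr a)"
      using assms by (intro mono_onD[OF f_mono]) auto
    then have "real m * f (K * real m powr a) \<le> real (Suc m) * f (K * real (Suc m) powr a)"
      using assms f_pos[of "K * real m powr a"] by (intro mult_mono) auto
    then show ?thesis
      unfolding g_def using assms that f_pos by (intro divide_left_mono mult_pos_pos) auto
  qed
  moreover have "0 \<le> g m" for m
    unfolding g_def using assms f_pos[of "K * real m powr a"] by auto
  ultimately have sm: "summable (\<lambda>k. 2 ^ k * g (2 ^ k))"
    by (subst (asm) condensation_test) auto
  \<comment> \<open>One factor \<open>2 ^ m\<close> absorbs \<open>K\<close>, and
    \<open>2 ^ (k * m)\<close> absorbs \<open>(2 ^ k) powr a\<close>.\<close>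
  obtain m :: nat where m: "m \<ge> 1" "a \<le> real m" "K \<le> 2 ^ m"
  proof -
    obtain m1 :: nat where "K < 2 ^ m1" using real_arch_pow[of 2 K] by auto
    moreover have "(2::real) ^ m1 \<le> 2 ^ max m1 (max 1 (nat \<lceil>a\<rceil>))"
      by (rule power_increasing) auto
    ultimately show ?thesis
      by (intro that[of "max m1 (max 1 (nat \<lceil>a\<rceil>))"]) (linarith | simp)+
  qed
  have "summable (\<lambda>k. u (Suc k * m))"
  proof (rule summable_comparison_test'[OF sm])
    fix k
    have "K * real (2 ^ k) powr a \<le> 2 ^ m * real (2 ^ k) powr real m"
      using m by (intro mult_mono powr_mono) auto
    also have "\<dots> = 2 ^ (Suc k * m)"
      by (simp add: powr_realpow power_add power_mult)
    finally have "u (Suc k * m) \<le> 1 / f (K * real (2 ^ k) powr a)"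
      unfolding u_def using assms by (intro recip_antimono) auto
    also have "\<dots> = 2 ^ k * g (2 ^ k)"
      unfolding g_def by simp
    finally show "norm (u (Suc k * m)) \<le> 2 ^ k * g (2 ^ k)"
      using f_pos[of "2 ^ (Suc k * m)"] by (simp add: u_def abs_of_pos del: mult_Suc)
  qed
  then have "summable (\<lambda>k. u (k * m))"
    by (subst (asm) summable_Suc_iff)
  then have "summable u"
  proof (rule summable_of_summable_multiples[rotated -1])
    show "decseq u"
      unfolding u_def decseq_def by (intro allI impI recip_antimono power_increasing) auto
    show "0 \<le> u n" for n using f_pos[of "2 ^ n"] by (simp add: u_def)
  qed (use m in auto)
  then have "summable (\<lambda>n. u (Suc n))" by (subst summable_Suc_iff)
  with f_div show False by (simp add: u_def)
qed

text \<open>If this failed, \<open>1 / f (2 ^ n)\<close> would eventually be dominated by a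
  geometric series of ratio \<open>2 powr (p - 1) < 1\<close>, contradicting divergence.\<close>

lemma exists_powr_mult_le:
  fixes p \<delta> Y :: real
  assumes "p < 1" "0 < \<delta>"
  shows "\<exists>y\<ge>Y. y powr (p - 1) * f y \<le> \<delta>"
proof (rule ccontr)
  assume H: "\<not> ?thesis"
  obtain N :: nat where N: "Y < 2 ^ N" using real_arch_pow[of 2 Y] by auto
  define c where "c = (2::real) powr (p - 1)"
  have two_pow: "(2 ^ k) powr (p - 1) = c ^ k" for k :: nat
    by (induction k) (simp_all add: c_def powr_mult)
  have "summable (\<lambda>n. (c / \<delta>) * c ^ n)"
    using assms by (intro summable_mult summable_geometric) (use powr_less_mono[of "p - 1" 0 2] in \<open>auto simp: c_def\<close>)
  then have "summable (\<lambda>n. 1 / f (2 ^ Suc n))"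
  proof (rule summable_comparison_test'[where N = N])
    fix n assume "n \<ge> N"
    then have "(2::real) ^ N \<le> 2 ^ Suc n" by (intro power_increasing) auto
    with N have "Y \<le> 2 ^ Suc n" by linarith
    with H have "\<delta> \<le> (2 ^ Suc n) powr (p - 1) * f (2 ^ Suc n)" by force
    also have "(2 ^ Suc n) powr (p - 1) = c ^ Suc n"
      by (rule two_pow)
    finally have "\<delta> \<le> c ^ Suc n * f (2 ^ Suc n)" .
    then show "norm (1 / f (2 ^ Suc n)) \<le> (c / \<delta>) * c ^ n"
      using f_pos[of "2 ^ Suc n"] assms by (simp add: field_simps)
  qed
  with f_div show False ..
qed

end

section \<open>Sums of the drifts\<close>

text \<open>Telescoping: \<open>1 / t \<le> 2 * (t - s)\<close> for consecutive roots
  \<open>s\<close>, \<open>t\<close> is a rearrangement of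
  \<open>(t - s)\<^sup>2 \<ge> 0\<close>.\<close>

lemma sum_inverse_sqrt_le: "(\<Sum>i=1..n. 1 / sqrt (real i)) \<le> 2 * sqrt (real n)"
proof (induction n)
  case (Suc n)
  define s t where "s = sqrt (real n)" and "t = sqrt (real (Suc n))"
  have "t\<^sup>2 = s\<^sup>2 + 1" "0 < t" "0 \<le> s" by (auto simp: s_def t_def)
  moreover have "0 \<le> (t - s)\<^sup>2" by simp
  ultimately have "2 * s * t + 1 \<le> 2 * t * t"
    unfolding power2_diff by (simp add: power2_eq_square algebra_simps)
  then have "2 * s + 1 / t \<le> 2 * t"
    using \<open>0 < t\<close> by (simp add: field_simps)
  with Suc show ?case by (simp add: s_def t_def)
qed simp

text \<open>Splitting off the exponent -1/2 leaves the increasing factor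
  \<open>i powr (a - 1 / 2)\<close>, which is bounded by its value at \<open>n\<close>; this reduces
  the claim to square roots.\<close>

lemma sum_powr_minus_one_le:
  fixes a :: real
  assumes "1 / 2 \<le> a"
  shows "(\<Sum>i=1..n. real i powr (a - 1)) \<le> 2 * real n powr a"
proof -
  have "(\<Sum>i=1..n. real i powr (a - 1)) \<le> (\<Sum>i=1..n. real n powr (a - 1 / 2) * (1 / sqrt (real i)))"
  proof (rule sum_mono)
    fix i assume i: "i \<in> {1..n}"
    have "real i powr (a - 1) = real i powr (a - 1 / 2) * real i powr (- (1 / 2))"
      by (simp flip: powr_add)
    also have "real i powr (- (1 / 2)) = 1 / sqrt (real i)"
      by (subst powr_minus) (simp add: powr_half_sqrt inverse_eq_divide)
    also have "real i powr (a - 1 / 2) * (1 / sqrt (real i)) \<le> real n powr (a - 1 / 2) * (1 / sqrt (real i))"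
      using i assms by (intro mult_right_mono powr_mono2) auto
    finally show "real i powr (a - 1) \<le> real n powr (a - 1 / 2) * (1 / sqrt (real i))" .
  qed
  also have "\<dots> = real n powr (a - 1 / 2) * (\<Sum>i=1..n. 1 / sqrt (real i))"
    by (simp add: sum_distrib_left)
  also have "\<dots> \<le> real n powr (a - 1 / 2) * (2 * sqrt (real n))"
    by (intro mult_left_mono sum_inverse_sqrt_le) auto
  also have "\<dots> = 2 * (real n powr (a - 1 / 2) * real n powr (1 / 2))"
    by (simp add: powr_half_sqrt)
  also have "\<dots> = 2 * real n powr a"
    by (subst powr_add[symmetric]) simp
  finally show ?thesis .
qed

section \<open>The centered marginal laws\<close>

text \<open>Centering forces \<open>y * v = x * q\<close>, so the choice of \<open>y\<close> must
  control the moment at \<open>- y\<close>: it is at most \<open>f 1\<close> for a drift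
  \<open>y \<le> 1\<close> and at most 1 for a rare huge \<open>y\<close>. The bounds
  \<open>1 / 2 ^ (n + 2)\<close> sum to at most 1/4, the allowance in
  \<open>prob_partial_sum_gt\<close>.\<close>

lemma exists_marginal:
  fixes f :: "real \<Rightarrow> real" and a p K :: real and n :: nat
  assumes f_pos: "\<And>x. 0 \<le> x \<Longrightarrow> 0 < f x"
    and f_mono: "mono_on {0..} f"
    and f_div: "\<not> summable (\<lambda>n. 1 / f (2 ^ Suc n))"
    and a: "0 < a" "1 \<le> p * a" and K: "3 \<le> K" and n: "1 \<le> n"
  defines "x \<equiv> K * real n powr a"
  defines "q \<equiv> f 0 / (8 * K) / (real n powr (p * a) * f x)"
  shows "\<exists>\<mu> :: real pmf. measure \<mu> {x..} = q \<and>
    measure \<mu> {..<- (real n powr (a - 1) / 2)} \<le> 1 / 2 ^ (n + 2) \<and>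
    integrable \<mu> (\<lambda>z. z) \<and> (LINT z|\<mu>. z) = 0 \<and>
    (\<integral>\<^sup>+z. ennreal (\<bar>z\<bar> powr p * f \<bar>z\<bar>) \<partial>\<mu>) \<le> ennreal (f 0 / (8 * K) * K powr p + f 1 + 1)"
proof -
  have p: "0 < p" using a by (auto intro: zero_less_mult_pos2[of p a] less_le_trans[OF zero_less_one])
  have x: "0 < x" using K n by (auto simp: x_def)
  have fx: "0 < f x" "f 0 \<le> f x" and f0: "0 < f 0"
    using x f_pos mono_onD[OF f_mono, of 0 x] by auto
  have q0: "0 < q" unfolding q_def using f0 fx K n by auto
  \<comment> \<open>Replacing \<open>f x\<close> by \<open>f 0\<close> cancels the
    \<open>f 0\<close> built into the constant and frees the bound from \<open>f\<close>.\<close>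
  have "f 0 / (8 * K) / (real n powr (p * a) * f x) \<le> f 0 / (8 * K) / (real n powr (p * a) * f 0)"
    using f0 fx K n by (intro divide_left_mono mult_left_mono mult_pos_pos) auto
  then have q: "q \<le> real n powr (- (p * a)) / (8 * K)"
    using f0 unfolding q_def by (simp add: powr_minus field_simps)
  have "real n powr (- (p * a)) \<le> real n powr 0"
    using n a by (intro powr_mono) auto
  then have "real n powr (- (p * a)) \<le> 1" using n by simp
  then have "real n powr (- (p * a)) / (8 * K) \<le> 1 / 8"
    using K by (simp add: field_simps)
  with q have q8: "q \<le> 1 / 8" by linarith
  \<comment> \<open>The \<open>K\<close> of \<open>8 * K\<close> cancels the one inside
    \<open>x\<close>. The remaining power is at most \<open>n powr (a - 1)\<close>, since
    \<open>1 \<le> p * a\<close>, and at most 1 if \<open>1 \<le> p\<close>.\<close>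
  have "x * q \<le> x * (real n powr (- (p * a)) / (8 * K))"
    using q x by (intro mult_left_mono) auto
  also have "\<dots> = real n powr (a - p * a) / 8"
    using K by (simp add: x_def powr_diff powr_minus field_simps)
  finally have xq: "x * q \<le> real n powr (a - p * a) / 8" .
  have up: "x powr p * f x * q = f 0 / (8 * K) * K powr p"
    using fx K n by (simp add: q_def x_def powr_mult powr_powr mult.commute)
  \<comment> \<open>The final disjunction: either \<open>- y\<close> stays above the drift threshold
    and never counts as low, or its mass is tiny.\<close>
  obtain y v where yv: "0 < y" "0 \<le> v" "q + v \<le> 1" "x * q = y * v"
      "y powr p * f y * v \<le> f 1 + 1" "y \<le> real n powr (a - 1) / 2 \<or> v \<le> 1 / 2 ^ (n + 2)"
  proof (cases "1 \<le> p")
    case True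
    define y where "y = x * q / (1 - q)"
    have y0: "0 < y" using x q0 q8 by (simp add: y_def)
    have "1 \<le> 2 * (1 - q)" using q8 by simp
    then have "x * q * 1 \<le> x * q * (2 * (1 - q))"
      using x q0 by (intro mult_left_mono) auto
    then have "y \<le> 2 * (x * q)" using q8 by (simp add: y_def divide_le_eq mult_ac)
    with xq have "y \<le> real n powr (a - p * a) / 2"
      using powr_ge_zero[of "real n" "a - p * a"] by linarith
    moreover have "real n powr (a - p * a) \<le> real n powr (a - 1)"
      using n a by (intro powr_mono) auto
    moreover have "real n powr (a - p * a) \<le> real n powr 0"
      using n a True by (intro powr_mono) (auto simp: mult_le_cancel_right1)
    ultimately have y1: "y \<le> 1" "y \<le> real n powr (a - 1) / 2" using n by auto
    have "y powr p * f y * (1 - q) \<le> 1 * f 1 * 1"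
      using y0 y1 p q0 q8 f_pos f_mono
      by (intro mult_mono powr_le1 mono_onD[OF f_mono]) (auto intro: mult_nonneg_nonneg less_imp_le)
    then show ?thesis
      using y0 y1 q0 q8 by (intro that[of y "1 - q"]) (auto simp: y_def)
  next
    case False
    \<comment> \<open>With \<open>v = x * q / y\<close> the moment at \<open>- y\<close> is
      \<open>y powr (p - 1) * f y * (x * q)\<close>, which this \<open>\<delta>\<close> bounds by 1;
      the lower bound \<open>x * q * 2 ^ (n + 2)\<close> on \<open>y\<close> makes \<open>v\<close>
      small.\<close>
    define \<delta> where "\<delta> = 1 / (x * q)"
    have "0 < x * q" using x q0 by simp
    then have "0 < \<delta>" by (simp add: \<delta>_def)
    obtain y where y: "max 1 (x * q * 2 ^ (n + 2)) \<le> y" "y powr (p - 1) * f y \<le> \<delta>"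
      using exists_powr_mult_le[OF f_pos f_mono f_div _ \<open>0 < \<delta>\<close>, of p] False by (meson not_le)
    have y1: "1 \<le> y" "x * q * 2 ^ (n + 2) \<le> y" using y by simp_all
    define v where "v = x * q / y"
    have v: "v \<le> 1 / 2 ^ (n + 2)"
      unfolding v_def using y1 by (simp add: field_simps)
    have "(1::real) / 2 ^ (n + 2) \<le> 1 / 2 ^ 2"
      by (intro divide_left_mono power_increasing) auto
    also have "\<dots> = (1::real) / 4" by simp
    finally have "v \<le> 1 / 4" using v by linarith
    have "y powr p * f y * v = y powr (p - 1) * f y * (x * q)"
      using y1 by (simp add: v_def powr_diff)
    also have "\<dots> \<le> \<delta> * (x * q)"
      using y(2) \<open>0 < x * q\<close> by (intro mult_right_mono) auto
    also have "\<dots> = 1" using x q0 by (simp add: \<delta>_def)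
    finally have "y powr p * f y * v \<le> f 1 + 1" using f_pos[of 1] by simp
    moreover have "0 \<le> v" "x * q = y * v"
      using y1 \<open>0 < x * q\<close> by (simp_all add: v_def)
    moreover have "q + v \<le> 1" using q8 \<open>v \<le> 1 / 4\<close> by simp
    ultimately show ?thesis
      using y1 v by (intro that[of y v]) simp_all
  qed
  note tp = x yv(1) less_imp_le[OF q0] yv(2,3)
  define \<mu> where "\<mu> = three_point x q y v"
  have "measure \<mu> {x..} = q"
    unfolding \<mu>_def measure_three_point[OF tp] using x yv by (auto simp: indicator_def)
  moreover have "\<not> x < - (real n powr (a - 1) / 2)" "\<not> 0 < - (real n powr (a - 1) / 2)"
    using powr_ge_zero[of "real n" "a - 1"] x by linarith+
  then have "measure \<mu> {..<- (real n powr (a - 1) / 2)} \<le> 1 / 2 ^ (n + 2)"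
    unfolding \<mu>_def measure_three_point[OF tp] using yv(6) by (auto simp: indicator_def)
  moreover have "integrable \<mu> (\<lambda>z. z)" "(LINT z|\<mu>. z) = 0"
    unfolding \<mu>_def using integrable_three_point[OF tp] integral_three_point[OF tp] yv(4) by auto
  moreover have "(\<integral>\<^sup>+z. ennreal (\<bar>z\<bar> powr p * f \<bar>z\<bar>) \<partial>\<mu>) =
      ennreal (x powr p * f x) * q + ennreal (y powr p * f y) * v"
    unfolding \<mu>_def by (subst nn_integral_three_point[OF tp]) (use x yv in auto)
  moreover have "\<dots> = ennreal (x powr p * f x * q + y powr p * f y * v)"
    using q0 yv fx f_pos[of y] by (simp add: ennreal_mult'' ennreal_plus)
  moreover have "\<dots> \<le> ennreal (f 0 / (8 * K) * K powr p + f 1 + 1)"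
    using yv(5) up by (intro ennreal_leI) linarith
  ultimately show ?thesis by auto
qed

section \<open>Assembling the sequence\<close>

theorem theorem6p5:
  fixes f :: "real \<Rightarrow> real" and r p :: real
  assumes f_pos: "\<And>x. 0 \<le> x \<Longrightarrow> 0 < f x"
    and f_mono: "mono_on {0..} f"
    and f_div: "(\<Sum>n. ennreal (1 / f (2 ^ Suc n))) = \<infinity>"
    and r: "0 < r" "r < 2"
    and p: "r \<le> p"
  shows "\<exists>(M :: (nat \<Rightarrow> real) measure) (X :: nat \<Rightarrow> (nat \<Rightarrow> real) \<Rightarrow> real).
    prob_space M \<and>
    prob_space.indep_vars M (\<lambda>_. borel) X {1..} \<and>
    (\<forall>n\<ge>1. centered M (X n)) \<and>
    (SUP n\<in>{1..}. \<integral>\<^sup>+ \<omega>. ennreal (\<bar>X n \<omega>\<bar> powr p * f \<bar>X n \<omega>\<bar>) \<partial>M) < \<infinity> \<and>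
    (\<Sum>n. ennreal (real (Suc n) powr (p / r - 2) *
        measure M {\<omega> \<in> space M. \<bar>partial_sum X (Suc n) \<omega>\<bar> > real (Suc n) powr (1 / r)})) = \<infinity> \<and>
    (r = p \<longrightarrow>
      (AE \<omega> in M. limsup (\<lambda>n. ereal (real n powr (- 1 / p) * partial_sum X n \<omega>)) \<ge> 1))"
proof -
  define a where "a = 1 / r"
  \<comment> \<open>For \<open>2 * i \<ge> n\<close> the factor \<open>2 powr a\<close> gives
    \<open>x i \<ge> 3 * n powr a\<close>, beyond the \<open>2 * t\<close> of
    \<open>prob_partial_sum_gt\<close> with \<open>t = n powr a\<close>.\<close>
  define K where "K = 3 * 2 powr a"
  define x where "x n = K * real n powr a" for n :: nat
  define c where "c = f 0 / (8 * K)"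
  define q where "q n = c / (real n powr (p * a) * f (x n))" for n :: nat
  define h where "h n = real n powr (a - 1) / 2" for n :: nat
  define C where "C = c * K powr p + f 1 + 1"
  define g where "g n = 1 / (real n * f (x n))" for n :: nat
  \<comment> \<open>Here \<open>r < 2\<close> enters, through the drift sum, and
    \<open>r \<le> p\<close>, through the size of \<open>q\<close>.\<close>
  have a: "0 < a" "1 / 2 \<le> a" and pa: "1 \<le> p * a"
    using r p by (simp_all add: a_def le_divide_eq)
  have "2 powr 0 \<le> 2 powr a" using a by (intro powr_mono) auto
  then have K: "3 \<le> K" by (simp add: K_def)
  have x0: "0 \<le> x n" for n using K by (simp add: x_def)
  have c: "0 < c" using f_pos[of 0] K by (simp add: c_def)
  have div: "\<not> summable (\<lambda>n. 1 / f (2 ^ Suc n))"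
  proof
    assume "summable (\<lambda>n. 1 / f (2 ^ Suc n))"
    then have "(\<Sum>n. ennreal (1 / f (2 ^ Suc n))) \<noteq> top"
      by (rule ennreal_suminf_neq_top) (simp add: f_pos less_imp_le)
    with f_div show False by simp
  qed
  have g: "\<not> summable g"
    unfolding g_def x_def
    by (rule not_summable_powr_dilation[OF f_pos f_mono div]) (use K a in auto)
  define good where "good n \<nu> \<longleftrightarrow> measure \<nu> {x n..} = q n \<and>
      measure \<nu> {..<- h n} \<le> 1 / 2 ^ (n + 2) \<and> integrable \<nu> (\<lambda>z. z) \<and> (LINT z|\<nu>. z) = 0 \<and>
      (\<integral>\<^sup>+z. ennreal (\<bar>z\<bar> powr p * f \<bar>z\<bar>) \<partial>\<nu>) \<le> ennreal C" for n and \<nu> :: "real pmf"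
  have "\<exists>\<nu>. good n \<nu>" if "1 \<le> n" for n
    unfolding good_def x_def q_def h_def C_def c_def
    by (rule exists_marginal[OF f_pos f_mono div a(1) pa K that])
  \<comment> \<open>Nothing is known about \<open>\<mu> 0\<close>, so the estimates on the laws
    carry \<open>1 \<le> n\<close> and the comparisons for the limes superior start at
    \<open>N = 1\<close>.\<close>
  then obtain \<mu> where "\<And>n. 1 \<le> n \<Longrightarrow> good n (\<mu> n)" by metis
  then have \<mu>: "measure (\<mu> n) {x n..} = q n" "measure (\<mu> n) {..<- h n} \<le> 1 / 2 ^ (n + 2)"
      "integrable (\<mu> n) (\<lambda>z. z)" "(LINT z|\<mu> n. z) = 0"
      "(\<integral>\<^sup>+z. ennreal (\<bar>z\<bar> powr p * f \<bar>z\<bar>) \<partial>\<mu> n) \<le> ennreal C" if "1 \<le> n" for n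
    using that unfolding good_def by blast+
  obtain M :: "(nat \<Rightarrow> real) measure" where "prob_space M"
      and indep: "prob_space.indep_vars M (\<lambda>_. borel) (\<lambda>i \<omega>. \<omega> i) UNIV"
      and distr: "\<And>i. distr M borel (\<lambda>\<omega>. \<omega> i) = distr (\<mu> i) borel (\<lambda>x. x)"
    using prob_space_coordinates[of \<mu>] by blast
  interpret prob_space M by fact
  define X :: "nat \<Rightarrow> (nat \<Rightarrow> real) \<Rightarrow> real" where "X = (\<lambda>i \<omega>. \<omega> i)"
  have indep: "indep_vars (\<lambda>_. borel) X UNIV" using indep by (simp add: X_def)
  have distr: "distr M borel (X i) = distr (\<mu> i) borel (\<lambda>x. x)" for i
    using distr by (simp add: X_def)
  have rv [measurable]: "X i \<in> borel_measurable M" for i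
    using indep by (auto simp: indep_vars_def2)
  have prob_X: "prob {\<omega> \<in> space M. X i \<omega> \<in> B} = measure (\<mu> i) B" if "B \<in> sets borel" for i B
  proof -
    have "prob {\<omega> \<in> space M. X i \<omega> \<in> B} = measure (distr M borel (X i)) B"
      using that by (subst measure_distr) (auto intro: arg_cong[where f = prob])
    also have "\<dots> = measure (\<mu> i) B"
      unfolding distr using that by (subst measure_distr) auto
    finally show ?thesis .
  qed
  have up: "prob {\<omega> \<in> space M. x n \<le> X n \<omega>} = q n" if "1 \<le> n" for n
    using prob_X[of "{x n..}" n] \<mu>(1)[OF that] by simp
  have low: "prob {\<omega> \<in> space M. X n \<omega> < - h n} \<le> 1 / 2 ^ (n + 2)" if "1 \<le> n" for n
    using prob_X[of "{..<- h n}" n] \<mu>(2)[OF that] by simp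
  have h: "0 \<le> h n" "(\<Sum>j=1..n. h j) \<le> real n powr a" for n
    using sum_powr_minus_one_le[OF a(2), of n] by (simp_all add: h_def flip: sum_divide_distrib)

  have centered: "centered M (X n)" if "1 \<le> n" for n
  proof -
    have id: "(\<lambda>z. z) \<in> measurable (\<mu> n) borel" by simp
    have "integrable M (X n) \<longleftrightarrow> integrable (distr M borel (X n)) (\<lambda>z. z)"
      by (rule integrable_distr_eq[OF rv, symmetric]) simp
    also have "\<dots> \<longleftrightarrow> integrable (\<mu> n) (\<lambda>z. z)"
      unfolding distr by (rule integrable_distr_eq[OF id]) simp
    finally have "integrable M (X n)" using \<mu>(3)[OF that] by blast
    moreover have "integral\<^sup>L M (X n) = integral\<^sup>L (distr M borel (X n)) (\<lambda>z. z)"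
      by (rule integral_distr[OF rv, symmetric]) simp
    moreover have "\<dots> = (LINT z|\<mu> n. z)"
      unfolding distr by (rule integral_distr[OF id]) simp
    moreover note \<mu>(4)[OF that]
    ultimately show ?thesis unfolding centered_def by simp
  qed

  have moment: "(\<integral>\<^sup>+ \<omega>. ennreal (\<bar>X n \<omega>\<bar> powr p * f \<bar>X n \<omega>\<bar>) \<partial>M) \<le> ennreal C" if "1 \<le> n" for n
  proof -
    \<comment> \<open>\<open>f\<close> is monotone on \<open>{0..}\<close> only; composing with
      \<open>max z 0\<close> gives a function monotone on the whole line, hence Borel.\<close>
    have "mono (\<lambda>z. f (max z 0))"
      by (intro monoI mono_onD[OF f_mono]) auto
    then have "(\<lambda>z. f (max z 0)) \<in> borel_measurable borel"
      by (rule borel_measurable_mono)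
    then have "(\<lambda>z. f (max \<bar>z\<bar> 0)) \<in> borel_measurable borel"
      by (rule measurable_compose[rotated]) measurable
    then have [measurable]: "(\<lambda>z. f \<bar>z\<bar>) \<in> borel_measurable borel"
      by (simp add: max_absorb1)
    have "(\<integral>\<^sup>+ \<omega>. ennreal (\<bar>X n \<omega>\<bar> powr p * f \<bar>X n \<omega>\<bar>) \<partial>M) =
        (\<integral>\<^sup>+ z. ennreal (\<bar>z\<bar> powr p * f \<bar>z\<bar>) \<partial>distr M borel (X n))"
      by (rule nn_integral_distr[OF rv, symmetric]) measurable
    also have "\<dots> = (\<integral>\<^sup>+ z. ennreal (\<bar>z\<bar> powr p * f \<bar>z\<bar>) \<partial>\<mu> n)"
      unfolding distr by (rule nn_integral_distr) simp_all
    finally show ?thesis using \<mu>(5)[OF that] by simp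
  qed

  have q_le: "q n \<le> 1 / (8 * real n)" if "1 \<le> n" for n
  proof -
    have "real n powr 1 \<le> real n powr (p * a)"
      using that pa by (intro powr_mono) auto
    moreover have "f 0 \<le> f (x n)" using x0 by (intro mono_onD[OF f_mono]) auto
    ultimately have "real n * f 0 \<le> real n powr (p * a) * f (x n)"
      using that f_pos[of 0] by (intro mult_mono) auto
    then have "q n \<le> c / (real n * f 0)"
      unfolding q_def using that f_pos[of 0] c f_pos[OF x0, of n] by (intro divide_left_mono) auto
    also have "\<dots> = 1 / (8 * K * real n)"
      using f_pos[of 0] by (simp add: c_def)
    also have "\<dots> \<le> 1 / (8 * real n)"
      using K that by (intro divide_left_mono) auto
    finally show ?thesis .
  qed

  have tail: "c / 4 * g n \<le> real n powr (p * a - 2) *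
      prob {\<omega> \<in> space M. real n powr a < \<bar>partial_sum X n \<omega>\<bar>}" if n: "1 \<le> n" for n
  proof -
    \<comment> \<open>This upper half has at least \<open>n / 2\<close> indices, and each
      \<open>q i\<close> on it is at most \<open>1 / (4 * n)\<close>, so the jump probabilities sum
      to at most 1/4.\<close>
    define I where "I = {n div 2<..n}"
    have I: "I \<subseteq> {1..n}" "\<And>i. i \<in> I \<Longrightarrow> real n / 2 \<le> real i" by (auto simp: I_def)
    have cardI: "card I \<le> n" "real n / 2 \<le> real (card I)" by (auto simp: I_def)
    have x: "2 * real n powr a < x i" if "i \<in> I" for i
    proof -
      have "real n powr a \<le> (2 * real i) powr a"
        using I(2)[OF that] a by (intro powr_mono2) auto
      then have "3 * real n powr a \<le> x i"
        by (simp add: x_def K_def powr_mult)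
      moreover have "0 < real n powr a" using n by simp
      ultimately show ?thesis by linarith
    qed
    have sum_up: "(\<Sum>i\<in>I. prob {\<omega> \<in> space M. x i \<le> X i \<omega>}) = (\<Sum>i\<in>I. q i)"
      using I by (intro sum.cong up) auto
    have "q i \<le> 1 / (4 * real n)" if "i \<in> I" for i
    proof -
      have i: "1 \<le> i" using I(1) that by auto
      have "1 / (8 * real i) \<le> 1 / (4 * real n)"
        using I(2)[OF that] n i by (intro divide_left_mono) auto
      with q_le[OF i] show ?thesis by linarith
    qed
    then have "(\<Sum>i\<in>I. q i) \<le> real (card I) * (1 / (4 * real n))"
      by (rule sum_bounded_above)
    also have "\<dots> \<le> real n * (1 / (4 * real n))"
      using cardI by (intro mult_right_mono) auto
    finally have q4: "(\<Sum>i\<in>I. q i) \<le> 1 / 4" using n by simp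
    have "(\<Sum>j=1..n. prob {\<omega> \<in> space M. X j \<omega> < - h j}) \<le> (\<Sum>j=1..n. 1 / 2 ^ (j + 2))"
      by (intro sum_mono low) auto
    also have "\<dots> = 1 / 4 - 1 / 2 ^ (n + 2)"
      by (induction n) (auto simp: field_simps)
    also have "\<dots> \<le> 1 / 4" by simp
    finally have "(\<Sum>i\<in>I. q i) / 2 \<le> prob {\<omega> \<in> space M. real n powr a < \<bar>partial_sum X n \<omega>\<bar>}"
      using prob_partial_sum_gt[where x = x, OF indep h I(1) x] q4 unfolding sum_up by simp
    moreover have "real n / 2 * q n \<le> (\<Sum>i\<in>I. q i)"
    proof -
      have "q n \<le> q i" if "i \<in> I" for i
      proof -
        have i: "1 \<le> i" "i \<le> n" using I(1) that by auto
        then have "real i powr (p * a) \<le> real n powr (p * a)" "x i \<le> x n"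
          using pa a K by (auto simp: x_def intro!: powr_mono2 mult_left_mono)
        moreover from this have "f (x i) \<le> f (x n)"
          using x0 by (intro mono_onD[OF f_mono]) auto
        moreover have "0 < real i powr (p * a)" "0 < f (x i)"
          using i f_pos[OF x0] by auto
        ultimately have "real i powr (p * a) * f (x i) \<le> real n powr (p * a) * f (x n)"
            "0 < real i powr (p * a) * f (x i)"
          by (simp_all add: mult_mono)
        then show ?thesis
          unfolding q_def using c by (intro frac_le) auto
      qed
      then have "real (card I) * q n \<le> (\<Sum>i\<in>I. q i)"
        by (rule sum_bounded_below)
      moreover have "real n / 2 * q n \<le> real (card I) * q n"
        using cardI c f_pos[OF x0, of n] by (intro mult_right_mono) (auto simp: q_def)
      ultimately show ?thesis by linarith
    qed
    ultimately have "real n / 4 * q n \<le> prob {\<omega> \<in> space M. real n powr a < \<bar>partial_sum X n \<omega>\<bar>}"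
      by linarith
    then have "real n powr (p * a - 2) * (real n / 4 * q n) \<le> real n powr (p * a - 2) *
        prob {\<omega> \<in> space M. real n powr a < \<bar>partial_sum X n \<omega>\<bar>}"
      by (rule mult_left_mono) simp
    \<comment> \<open>The power \<open>n powr (p * a)\<close> in the denominator of
      \<open>q n\<close> cancels the weight up to \<open>1 / n\<close>.\<close>
    also have "real n powr (p * a - 2) * (real n / 4 * q n) = c / 4 * g n"
      using n by (simp add: powr_diff q_def g_def power2_eq_square)
    finally show ?thesis .
  qed
  have tails: "(\<Sum>n. ennreal (real (Suc n) powr (p / r - 2) *
      prob {\<omega> \<in> space M. \<bar>partial_sum X (Suc n) \<omega>\<bar> > real (Suc n) powr (1 / r)})) = \<infinity>"
  proof (rule ccontr)
    assume "\<not> ?thesis"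
    then have "summable (\<lambda>n. real (Suc n) powr (p / r - 2) *
      prob {\<omega> \<in> space M. \<bar>partial_sum X (Suc n) \<omega>\<bar> > real (Suc n) powr (1 / r)})"
      by (intro summable_suminf_not_top) auto
    then have "summable (\<lambda>n. c / 4 * g (Suc n))"
    proof (rule summable_comparison_test')
      fix n
      have "0 \<le> c / 4 * g (Suc n)"
        using c f_pos[OF x0, of "Suc n"] by (simp add: g_def)
      then show "norm (c / 4 * g (Suc n)) \<le> real (Suc n) powr (p / r - 2) *
          prob {\<omega> \<in> space M. \<bar>partial_sum X (Suc n) \<omega>\<bar> > real (Suc n) powr (1 / r)}"
        using tail[of "Suc n"] by (simp add: a_def)
    qed
    then have "summable g" using c by (simp add: summable_cmult_iff summable_Suc_iff)
    with g show False ..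
  qed

  have lim: "AE \<omega> in M. 1 \<le> limsup (\<lambda>n. ereal (real n powr (- 1 / p) * partial_sum X n \<omega>))"
    if "r = p"
  proof -
    have "p * a = 1" "- 1 / p = - a" using that r by (auto simp: a_def)
    have "AE \<omega> in M. 1 \<le> limsup (\<lambda>n. ereal (real n powr (- a) * partial_sum X n \<omega>))"
    proof (rule limsup_partial_sum_ge[OF indep a(1) h(2)])
      show "3 * real i powr a \<le> x i + h i" for i
        using K h(1)[of i] mult_right_mono[of 3 K "real i powr a"] by (simp add: x_def)
      have "summable (\<lambda>n. 1 / 4 * (1 / 2) ^ n :: real)"
        by (intro summable_mult summable_geometric) auto
      then show "summable (\<lambda>i. prob {\<omega> \<in> space M. X i \<omega> < - h i})"
        by (rule summable_comparison_test'[where N = 1]) (use low in \<open>auto simp: power_divide\<close>)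
      show "\<not> summable (\<lambda>i. prob {\<omega> \<in> space M. x i \<le> X i \<omega>})"
      proof
        assume "summable (\<lambda>i. prob {\<omega> \<in> space M. x i \<le> X i \<omega>})"
        then have "summable (\<lambda>i. c * g i)"
        proof (rule summable_comparison_test'[where N = 1])
          fix n :: nat assume n: "1 \<le> n"
          have "c * g n = q n" using n \<open>p * a = 1\<close> by (simp add: g_def q_def)
          moreover have "0 \<le> q n" unfolding up[OF n, symmetric] by (rule measure_nonneg)
          ultimately show "norm (c * g n) \<le> prob {\<omega> \<in> space M. x n \<le> X n \<omega>}"
            unfolding up[OF n] by simp
        qed
        with g c show False by (simp add: summable_cmult_iff)
      qed
    qed
    then show ?thesis unfolding \<open>- 1 / p = - a\<close> .
  qed

  have "(SUP n\<in>{1..}. \<integral>\<^sup>+ \<omega>. ennreal (\<bar>X n \<omega>\<bar> powr p * f \<bar>X n \<omega>\<bar>) \<partial>M) \<le> ennreal C"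
    by (intro SUP_least moment) auto
  then have "(SUP n\<in>{1..}. \<integral>\<^sup>+ \<omega>. ennreal (\<bar>X n \<omega>\<bar> powr p * f \<bar>X n \<omega>\<bar>) \<partial>M) < \<infinity>"
    by (rule le_less_trans) simp
  moreover have "indep_vars (\<lambda>_. borel) X {1..}"
    by (rule indep_vars_subset[OF indep]) simp
  ultimately show ?thesis
    using prob_space_axioms centered tails lim by blast
qed

end
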